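(* If $\Gamma\vdash_s M:A$ is derivable in the system $\Lambda_\cap^s$, then $M$ is strongly $\beta$-normalising.
   Context: $\lambda$-terms: $M::=x\mid MM\mid\lambda x.M$ modulo $\alpha$-conversion; $M[x:=N]$ is capture-avoiding substitution; $\beta$-reduction is the contextual closure of $(\lambda x.M)N\to M[x:=N]$; strongly normalising means every reduction sequence is finite. Types: $A::=\varphi\mid A\to A\mid A\cap A$. A typing context is a finite set of pairs $x:A$, where a variable may occur with several types; $\Gamma,x:A$ denotes $\Gamma\cup\{x:A\}$; $x\notin\Gamma$ means no $x:B$ lies in $\Gamma$. Rules of $\Lambda_\cap^s$ ($n\ge0$): (Ax) $\Gamma,x:A\vdash_s x:A$; $(\mathsf{Beta})^s$ from $\Gamma\vdash_s M[x:=N]N_1\dots N_n:A$ and $\Gamma\vdash_s N:B$ infer $\Gamma\vdash_s(\lambda x.M)NN_1\dots N_n:A$; $(\mathsf{L}\to)$ from $\Gamma\vdash_s N:A_1$ and $\Gamma,y:A_2\vdash_s yN_1\dots N_n:B$, with $y\notin FV(N_1)\cup\dots\cup FV(N_n)$ and $y\notin\Gamma$, infer $\Gamma,x:A_1\to A_2\vdash_s xNN_1\dots N_n:B$; $(\mathsf{R}\to)$ from $\Gamma,x:A\vdash_s M:B$, $x\notin\Gamma$, infer $\Gamma\vdash_s\lambda x.M:A\to B$; $(\mathsf{L}\cap)$ from $\Gamma,x:A_1,x:A_2\vdash_s xN_1\dots N_n:B$ infer $\Gamma,x:A_1\cap A_2\vdash_s xN_1\dots N_n:B$; $(\mathsf{R}\cap)$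 from $\Gamma\vdash_s M:A$ and $\Gamma\vdash_s M:B$ infer $\Gamma\vdash_s M:A\cap B$. *)

theory Defs
  imports Main "HOL-Library.FSet"
begin

text \<open>
  Terms modulo \<open>\<alpha>\<close>-conversion are represented by de Bruijn terms. An index pointing beyond
  all enclosing abstractions is a free variable: at the top level, \<open>Var i\<close> plays the role of the
  \<open>i\<close>-th variable name, and inside the body of an abstraction it is written \<open>Var (Suc i)\<close>, while
  \<open>Var 0\<close> is the variable bound by that abstraction.
\<close>

datatype trm = Var nat | App trm trm | Abs trm

primrec FV :: "trm \<Rightarrow> nat set" where
  "FV (Var i) = {i}"
| "FV (App s t) = FV s \<union> FV t"
| "FV (Abs t) = {i. Suc i \<in> FV t}"

primrec lift :: "nat \<Rightarrow> trm \<Rightarrow> trm" where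
  "lift k (Var i) = Var (if i < k then i else Suc i)"
| "lift k (App s t) = App (lift k s) (lift k t)"
| "lift k (Abs t) = Abs (lift (Suc k) t)"

text \<open>
  \<open>subst k u t\<close> replaces index \<open>k\<close> in \<open>t\<close> by \<open>u\<close> and removes \<open>k\<close> from the index space, so that
  \<open>subst 0 N M\<close> is \<open>M[x:=N]\<close> when \<open>Abs M\<close> is \<open>\<lambda>x. M\<close>.
\<close>

primrec subst :: "nat \<Rightarrow> trm \<Rightarrow> trm \<Rightarrow> trm" where
  "subst k u (Var i) = (if i < k then Var i else if i = k then u else Var (i - 1))"
| "subst k u (App s t) = App (subst k u s) (subst k u t)"
| "subst k u (Abs t) = Abs (subst (Suc k) (lift 0 u) t)"

inductive beta :: "trm \<Rightarrow> trm \<Rightarrow> bool"  (infix \<open>\<rightarrow>\<^sub>\<beta>\<close> 50) where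
  redex: "App (Abs M) N \<rightarrow>\<^sub>\<beta> subst 0 N M"
| appL: "M \<rightarrow>\<^sub>\<beta> M' \<Longrightarrow> App M N \<rightarrow>\<^sub>\<beta> App M' N"
| appR: "N \<rightarrow>\<^sub>\<beta> N' \<Longrightarrow> App M N \<rightarrow>\<^sub>\<beta> App M N'"
| abs: "M \<rightarrow>\<^sub>\<beta> M' \<Longrightarrow> Abs M \<rightarrow>\<^sub>\<beta> Abs M'"

definition strongly_normalising :: "trm \<Rightarrow> bool" where
  "strongly_normalising M \<longleftrightarrow> \<not> (\<exists>f :: nat \<Rightarrow> trm. f 0 = M \<and> (\<forall>i. f i \<rightarrow>\<^sub>\<beta> f (Suc i)))"

abbreviation apps :: "trm \<Rightarrow> trm list \<Rightarrow> trm"  (infixl \<open>\<bullet>\<bullet>\<close> 100) where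
  "M \<bullet>\<bullet> Ns \<equiv> foldl App M Ns"

datatype 'a ty =
    Atom 'a
  | Arrow "'a ty" "'a ty"  (infixr \<open>\<rightarrow>\<^sub>t\<close> 65)
  | Inter "'a ty" "'a ty"  (infixr \<open>\<inter>\<^sub>t\<close> 70)

type_synonym 'a ctx = "(nat \<times> 'a ty) fset"

definition dom_ctx :: "'a ctx \<Rightarrow> nat fset" where
  "dom_ctx \<Gamma> = fst |`| \<Gamma>"

text \<open>The context \<open>\<Gamma>\<close> as seen from inside the body of an abstraction.\<close>

definition shift_ctx :: "'a ctx \<Rightarrow> 'a ctx" where
  "shift_ctx \<Gamma> = (\<lambda>(x, A). (Suc x, A)) |`| \<Gamma>"

text \<open>
  In rule \<open>R_arrow\<close> the abstracted variable is the index \<open>0\<close> of the body. It does not occur in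
  \<open>shift_ctx \<Gamma>\<close>, so the side condition of that rule holds by construction.
\<close>

inductive typing_s :: "'a ctx \<Rightarrow> trm \<Rightarrow> 'a ty \<Rightarrow> bool"  (\<open>_ \<turnstile>\<^sub>s _ : _\<close> [51, 51, 51] 50) where
  Ax: "finsert (x, A) \<Gamma> \<turnstile>\<^sub>s Var x : A"
| Beta_s: "\<lbrakk> \<Gamma> \<turnstile>\<^sub>s subst 0 N M \<bullet>\<bullet> Ns : A; \<Gamma> \<turnstile>\<^sub>s N : B \<rbrakk>
    \<Longrightarrow> \<Gamma> \<turnstile>\<^sub>s App (Abs M) N \<bullet>\<bullet> Ns : A"
| L_arrow: "\<lbrakk> \<Gamma> \<turnstile>\<^sub>s N : A1; finsert (y, A2) \<Gamma> \<turnstile>\<^sub>s Var y \<bullet>\<bullet> Ns : B;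
      \<forall>P \<in> set Ns. y \<notin> FV P; y |\<notin>| dom_ctx \<Gamma> \<rbrakk>
    \<Longrightarrow> finsert (x, A1 \<rightarrow>\<^sub>t A2) \<Gamma> \<turnstile>\<^sub>s App (Var x) N \<bullet>\<bullet> Ns : B"
| R_arrow: "finsert (0, A) (shift_ctx \<Gamma>) \<turnstile>\<^sub>s M : B
    \<Longrightarrow> \<Gamma> \<turnstile>\<^sub>s Abs M : A \<rightarrow>\<^sub>t B"
| L_inter: "finsert (x, A1) (finsert (x, A2) \<Gamma>) \<turnstile>\<^sub>s Var x \<bullet>\<bullet> Ns : B
    \<Longrightarrow> finsert (x, A1 \<inter>\<^sub>t A2) \<Gamma> \<turnstile>\<^sub>s Var x \<bullet>\<bullet> Ns : B"
| R_inter: "\<lbrakk> \<Gamma> \<turnstile>\<^sub>s M : A; \<Gamma> \<turnstile>\<^sub>s M : B \<rbrakk>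
    \<Longrightarrow> \<Gamma> \<turnstile>\<^sub>s M : A \<inter>\<^sub>t B"

end

theory Submission
  imports Defs
begin

text \<open>
  Every rule of the system preserves strong normalisation of the subject, so no reducibility
  argument is needed. A term with a variable in head position is strongly normalising iff its
  arguments are, which settles the left rules. For \<open>Beta_s\<close>, the head expansion
  \<open>(\<lambda>x. M) N N\<^sub>1 \<dots> N\<^sub>n\<close> of a strongly normalising term, with \<open>N\<close> strongly normalising, is handled by
  a lexicographic induction on the reduction of \<open>N\<close> and then of \<open>M[x:=N] N\<^sub>1 \<dots> N\<^sub>n\<close>: a step inside
  \<open>N\<close> may be erased in the contractum but decreases the first component, and every other step is
  matched by a step of the contractum.
\<close>

lemma lift_lift: "i < Suc k \<Longrightarrow> lift i (lift k t) = lift (Suc k) (lift i t)"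
  by (induction t arbitrary: i k) auto

lemma lift_subst:
  "j < Suc i \<Longrightarrow> lift i (subst j s t) = subst j (lift i s) (lift (Suc i) t)"
  by (induction t arbitrary: i j s) (simp_all add: diff_Suc lift_lift split: nat.split)

lemma lift_subst_lt:
  "i < Suc j \<Longrightarrow> lift i (subst j s t) = subst (Suc j) (lift i s) (lift i t)"
  by (induction t arbitrary: i j s) (auto simp: lift_lift)

lemma subst_lift [simp]: "subst k s (lift k t) = t"
  by (induction t arbitrary: k s) simp_all

text \<open>The substitution lemma in de Bruijn form. With \<open>i = 0\<close> it says that
  contracting a redex commutes with substitution, the redex case of
  \<open>beta_subst\<close>.\<close>

lemma subst_subst:
  "i < Suc j \<Longrightarrow>
    subst i (subst j v u) (subst (Suc j) (lift i v) t) = subst j v (subst i u t)"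
  by (induction t arbitrary: i j u v)
    (simp_all add: diff_Suc lift_lift lift_subst_lt split: nat.split)

inductive_cases beta_VarE: "Var x \<rightarrow>\<^sub>\<beta> t"
inductive_cases beta_AppE [consumes 1, case_names redex appL appR]: "App M N \<rightarrow>\<^sub>\<beta> t"
inductive_cases beta_AbsE: "Abs M \<rightarrow>\<^sub>\<beta> t"

lemma beta_lift: "M \<rightarrow>\<^sub>\<beta> M' \<Longrightarrow> lift k M \<rightarrow>\<^sub>\<beta> lift k M'"
  by (induction arbitrary: k rule: beta.induct) (auto intro: beta.intros simp: lift_subst)

lemma beta_subst: "M \<rightarrow>\<^sub>\<beta> M' \<Longrightarrow> subst k N M \<rightarrow>\<^sub>\<beta> subst k N M'"
  by (induction arbitrary: k N rule: beta.induct)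
    (auto intro: beta.intros simp: subst_subst [symmetric])

lemma beta_star_App:
  assumes "beta\<^sup>*\<^sup>* M M'" and "beta\<^sup>*\<^sup>* N N'"
  shows "beta\<^sup>*\<^sup>* (App M N) (App M' N')"
proof -
  have "beta\<^sup>*\<^sup>* (App M N) (App M' N)"
    using assms(1) by induction (auto intro: beta.appL rtranclp.rtrancl_into_rtrancl)
  also have "beta\<^sup>*\<^sup>* (App M' N) (App M' N')"
    using assms(2) by induction (auto intro: beta.appR rtranclp.rtrancl_into_rtrancl)
  finally show ?thesis .
qed

lemma beta_star_Abs: "beta\<^sup>*\<^sup>* M M' \<Longrightarrow> beta\<^sup>*\<^sup>* (Abs M) (Abs M')"
  by (induction rule: rtranclp.induct) (auto intro: beta.abs rtranclp.rtrancl_into_rtrancl)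

lemma beta_star_apps: "beta\<^sup>*\<^sup>* M M' \<Longrightarrow> beta\<^sup>*\<^sup>* (M \<bullet>\<bullet> Ns) (M' \<bullet>\<bullet> Ns)"
  by (induction Ns arbitrary: M M') (auto intro: beta_star_App)

text \<open>Each copy of \<open>N\<close> in \<open>M\<close> takes one step, and there may be none
  or many copies, hence the reflexive transitive closure.\<close>

lemma beta_star_subst: "N \<rightarrow>\<^sub>\<beta> N' \<Longrightarrow> beta\<^sup>*\<^sup>* (subst k N M) (subst k N' M)"
  by (induction M arbitrary: k N N') (simp_all add: beta_star_App beta_star_Abs beta_lift r_into_rtranclp)

lemma beta_apps: "M \<rightarrow>\<^sub>\<beta> M' \<Longrightarrow> M \<bullet>\<bullet> Ns \<rightarrow>\<^sub>\<beta> M' \<bullet>\<bullet> Ns"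
  by (induction Ns arbitrary: M M') (auto intro: beta.appL)

lemma apps_App_neq_Abs: "App P Q \<bullet>\<bullet> Ns \<noteq> Abs M"
  by (induction Ns arbitrary: P Q) auto

text \<open>A head that is an application never forms a redex with the arguments after it, so a step
  acts in the head or in one argument. The second case quantifies over \<open>H\<close> so that the
  same step can be replayed on the contractum.\<close>

lemma beta_apps_AppE:
  assumes "App P Q \<bullet>\<bullet> Ns \<rightarrow>\<^sub>\<beta> t"
  obtains (head) R where "App P Q \<rightarrow>\<^sub>\<beta> R" "t = R \<bullet>\<bullet> Ns"
  | (args) Ns' where "t = App P Q \<bullet>\<bullet> Ns'" "\<And>H. H \<bullet>\<bullet> Ns \<rightarrow>\<^sub>\<beta> H \<bullet>\<bullet> Ns'"
proof -
  have "(\<exists>R. App P Q \<rightarrow>\<^sub>\<beta> R \<and> t = R \<bullet>\<bullet> Ns) \<or>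
    (\<exists>Ns'. t = App P Q \<bullet>\<bullet> Ns' \<and> (\<forall>H. H \<bullet>\<bullet> Ns \<rightarrow>\<^sub>\<beta> H \<bullet>\<bullet> Ns'))"
    using assms
  proof (induction Ns arbitrary: t rule: rev_induct)
    case Nil
    then show ?case by simp
  next
    case (snoc N Ns)
    from snoc.prems have "App (App P Q \<bullet>\<bullet> Ns) N \<rightarrow>\<^sub>\<beta> t" by simp
    then show ?case
    proof (cases rule: beta_AppE)
      case redex
      then show ?thesis by (metis apps_App_neq_Abs)
    next
      case (appL M')
      from snoc.IH [OF appL(2)] show ?thesis
      proof (elim disjE exE conjE)
        fix R assume "App P Q \<rightarrow>\<^sub>\<beta> R" "M' = R \<bullet>\<bullet> Ns"
        then show ?thesis using appL(1) by auto
      next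
        fix Ns' assume "M' = App P Q \<bullet>\<bullet> Ns'" "\<forall>H. H \<bullet>\<bullet> Ns \<rightarrow>\<^sub>\<beta> H \<bullet>\<bullet> Ns'"
        then show ?thesis
          using appL(1) by (intro disjI2 exI [of _ "Ns' @ [N]"]) (auto intro: beta.appL)
      qed
    next
      case (appR N')
      then show ?thesis by (intro disjI2 exI [of _ "Ns @ [N']"]) (auto intro: beta.appR)
    qed
  qed
  then show thesis using that by blast
qed

text \<open>Accessibility under reduction, chosen because it comes with the induction principle that
  the proof runs on.\<close>

inductive SN :: "trm \<Rightarrow> bool" where
  SN_intro: "(\<And>t'. t \<rightarrow>\<^sub>\<beta> t' \<Longrightarrow> SN t') \<Longrightarrow> SN t"

lemma SN_beta: "SN t \<Longrightarrow> t \<rightarrow>\<^sub>\<beta> t' \<Longrightarrow> SN t'"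
  by (auto elim: SN.cases)

text \<open>The step also offers \<open>SN t\<close> for the current term; the redex case of
  \<open>SN_head_expansion\<close> needs it.\<close>

lemma SN_induct [consumes 1, case_names SN]:
  assumes "SN t" and "\<And>t. SN t \<Longrightarrow> (\<And>t'. t \<rightarrow>\<^sub>\<beta> t' \<Longrightarrow> P t') \<Longrightarrow> P t"
  shows "P t"
  using assms(1) by induction (auto intro: SN_intro assms(2))

lemma SN_beta_star: "beta\<^sup>*\<^sup>* t t' \<Longrightarrow> SN t \<Longrightarrow> SN t'"
  by (induction rule: rtranclp.induct) (auto intro: SN_beta)

lemma SN_imp_strongly_normalising:
  assumes "SN t"
  shows "strongly_normalising t"
proof -
  have "\<forall>f. f 0 = t \<longrightarrow> \<not> (\<forall>i. f i \<rightarrow>\<^sub>\<beta> f (Suc i))"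
    using assms
  proof (induction rule: SN_induct)
    case (SN t)
    show ?case
    proof (intro allI impI notI)
      fix f assume "f 0 = t" and f: "\<forall>i. f i \<rightarrow>\<^sub>\<beta> f (Suc i)"
      then have "t \<rightarrow>\<^sub>\<beta> f (Suc 0)" by metis
      from SN.IH [OF this, rule_format, of "\<lambda>i. f (Suc i)"] f show False by simp
    qed
  qed
  then show ?thesis unfolding strongly_normalising_def by blast
qed

text \<open>Reductions from \<open>s\<close> are mirrored from \<open>f s\<close>, so induction on
  \<open>f s\<close> applies. The instances of \<open>f\<close> are one-hole application
  contexts.\<close>

lemma SN_reflect:
  assumes "\<And>s s'. s \<rightarrow>\<^sub>\<beta> s' \<Longrightarrow> f s \<rightarrow>\<^sub>\<beta> f s'" and "SN (f s)"
  shows "SN s"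
  using assms(2)
  by (induction "f s" arbitrary: s rule: SN_induct) (auto intro: SN_intro assms(1))

lemma SN_AppD1: "SN (App M N) \<Longrightarrow> SN M"
  by (rule SN_reflect [of "\<lambda>M. App M N"]) (auto intro: beta.appL)

lemma SN_AppD2: "SN (App M N) \<Longrightarrow> SN N"
  by (rule SN_reflect [of "App M"]) (auto intro: beta.appR)

lemma SN_apps_argsD: "SN (M \<bullet>\<bullet> Ns) \<Longrightarrow> P \<in> set Ns \<Longrightarrow> SN P"
  by (induction Ns rule: rev_induct) (auto dest: SN_AppD1 SN_AppD2)

lemma SN_Var: "SN (Var x)"
  by (rule SN_intro) (auto elim: beta_VarE)

lemma SN_Abs: "SN M \<Longrightarrow> SN (Abs M)"
  by (induction rule: SN_induct) (auto intro: SN_intro elim: beta_AbsE)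

text \<open>An invariant of reduction that excludes abstractions, so reducts need not be decomposed
  into a variable and an argument list.\<close>

fun var_headed :: "trm \<Rightarrow> bool" where
  "var_headed (Var x) = True"
| "var_headed (App M N) = var_headed M"
| "var_headed (Abs M) = False"

lemma var_headed_beta: "M \<rightarrow>\<^sub>\<beta> M' \<Longrightarrow> var_headed M \<Longrightarrow> var_headed M'"
  by (induction rule: beta.induct) auto

lemma var_headed_apps: "var_headed (M \<bullet>\<bullet> Ns) = var_headed M"
  by (induction Ns arbitrary: M) auto

text \<open>\<open>M\<close> never reduces to an abstraction, so every step stays inside
  \<open>M\<close> or \<open>N\<close>; a nested induction covers both.\<close>

lemma SN_App_var_headed:
  assumes "SN M" and "SN N" and "var_headed M"
  shows "SN (App M N)"
  using assms
proof (induction arbitrary: N rule: SN_induct)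
  case (SN M)
  note M_IH = SN.IH and M_prems = SN.prems
  from M_prems(1) show ?case
  proof (induction rule: SN_induct)
    case (SN N)
    show ?case
    proof (rule SN_intro)
      fix t assume "App M N \<rightarrow>\<^sub>\<beta> t"
      then show "SN t"
        by (cases rule: beta_AppE) (use M_IH M_prems SN var_headed_beta in auto)
    qed
  qed
qed

lemma SN_Var_apps: "(\<And>P. P \<in> set Ns \<Longrightarrow> SN P) \<Longrightarrow> SN (Var x \<bullet>\<bullet> Ns)"
  by (induction Ns rule: rev_induct) (auto simp: SN_Var var_headed_apps intro: SN_App_var_headed)

lemma SN_head_expansion:
  assumes "SN N" and "SN (subst 0 N M \<bullet>\<bullet> Ns)"
  shows "SN (App (Abs M) N \<bullet>\<bullet> Ns)"
  using assms
proof (induction arbitrary: M Ns rule: SN_induct)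
  case (SN N)
  note N_IH = SN.IH
  \<comment> \<open>Inner induction on the contractum with \<open>N\<close> fixed; \<open>M\<close>
    and \<open>Ns\<close> vary since steps inside them change the decomposition.\<close>
  from SN.prems show ?case
  proof (induction "subst 0 N M \<bullet>\<bullet> Ns" arbitrary: M Ns rule: SN_induct)
    case SN
    show ?case
    proof (rule SN_intro)
      fix t assume "App (Abs M) N \<bullet>\<bullet> Ns \<rightarrow>\<^sub>\<beta> t"
      then show "SN t"
      proof (cases rule: beta_apps_AppE)
        case (head R)
        from head(1) show ?thesis
        proof (cases rule: beta_AppE)
          case redex
          then show ?thesis using SN.hyps(1) head(2) by simp
        next
          case (appL L)
          from appL(2) obtain M' where "L = Abs M'" "M \<rightarrow>\<^sub>\<beta> M'"
            by (auto elim: beta_AbsE)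
          then show ?thesis
            using SN.hyps(2) [of M' Ns] appL(1) head(2) by (simp add: beta_apps beta_subst)
        next
          case (appR N')
          \<comment> \<open>The contractum may not move at all here, so the outer hypothesis for
            \<open>N'\<close> is used.\<close>
          have "SN (subst 0 N' M \<bullet>\<bullet> Ns)"
            using SN_beta_star [OF beta_star_apps [OF beta_star_subst [OF appR(2)]] SN.hyps(1)] .
          then show ?thesis using N_IH [OF appR(2)] appR(1) head(2) by simp
        qed
      next
        case (args Ns')
        then show ?thesis using SN.hyps(2) [of M Ns'] by simp
      qed
    qed
  qed
qed

lemma typing_s_SN: "\<Gamma> \<turnstile>\<^sub>s M : A \<Longrightarrow> SN M"
proof (induction rule: typing_s.induct)
  case (Beta_s \<Gamma> N M Ns A B)
  then show ?case by (intro SN_head_expansion)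
next
  case (L_arrow \<Gamma> N A1 y A2 Ns B x)
  \<comment> \<open>The members of \<open>Ns\<close> inherit strong normalisation from
    \<open>Var y\<close> applied to \<open>Ns\<close>, and \<open>N\<close> has it from the first
    premise.\<close>
  then have "SN (Var x \<bullet>\<bullet> (N # Ns))"
    by (intro SN_Var_apps) (auto dest: SN_apps_argsD)
  then show ?case by simp
qed (simp_all add: SN_Var SN_Abs)

theorem theorem1:
  fixes \<Gamma> :: "'a ctx" and M :: trm and A :: "'a ty"
  assumes "\<Gamma> \<turnstile>\<^sub>s M : A"
  shows "strongly_normalising M"
  using assms by (intro SN_imp_strongly_normalising typing_s_SN)

end
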